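(* Let $\Theta=\{(\mu,\sigma^2,\rho):\ \mu\in\mathbb{R},\ \sigma^2>0,\ 0\le\rho\le 1\}$. For $\theta=(\mu,\sigma^2,\rho)\in\Theta$ let $X_1,X_2,\ldots$ be a sequence of real random variables such that for every $n\in\mathbb{N}$ the vector $(X_1,\ldots,X_n)^T$ has the $n$-variate Gaussian distribution ${\cal N}_n(\boldsymbol{\mu},\boldsymbol{\Sigma})$ with mean vector $\boldsymbol{\mu}=(\mu,\ldots,\mu)^T$ and covariance matrix $\boldsymbol{\Sigma}$ having all diagonal entries equal to $\sigma^2$ and all off-diagonal entries equal to $\rho\sigma^2$. Then $g(\theta)=\mu$ is not empirically identifiable, i.e., there is no sequence of estimators $T_n$ (measurable functions of $(X_1,\ldots,X_n)$) such that for every $\theta=(\mu,\sigma^2,\rho)\in\Theta$, $T_n(X_1,\ldots,X_n)\to\mu$ in probability as $n\to\infty$ when the sequence $(X_i)_{i\in\mathbb{N}}$ has the distribution with parameter $\theta$.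
   Context: Let $X_1,X_2,\ldots$ be random variables on a space ${\cal X}$ whose joint distribution is parameterised by $\theta\in\Theta$; $P_{\infty;\theta}$ denotes the distribution of the whole sequence. Let $g:\Theta\to\Lambda$ with $\Lambda$ a metric space. $g(\theta)$ is called empirically identifiable if there is a sequence of estimators $T_n:{\cal X}^n\to\Lambda$, $n\in\mathbb{N}$, such that for all $\theta\in\Theta$: $T_n(X_1,\ldots,X_n)\to g(\theta)$ in probability under $P_{\infty;\theta}$. Here ${\cal X}=\Lambda=\mathbb{R}$ with the usual metric. *)

theory Defs
  imports "HOL-Probability.Probability"
begin

definition tendsto_in_probability ::
    "'w measure \<Rightarrow> (nat \<Rightarrow> 'w \<Rightarrow> 'l::metric_space) \<Rightarrow> 'l \<Rightarrow> bool" where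
  "tendsto_in_probability M Y c \<longleftrightarrow>
     (\<forall>\<epsilon>>0. (\<lambda>n. measure M {\<omega> \<in> space M. dist (Y n \<omega>) c > \<epsilon>}) \<longlonglongrightarrow> 0)"

text \<open>
  \<open>P \<theta>\<close> is the distribution of the whole sequence, a measure on the product space over all of
  \<open>nat\<close>. The observations \<open>X\<^sub>1, \<dots>, X\<^sub>n\<close> are the coordinates \<open>0, \<dots>, n - 1\<close>, so
  that an estimator \<open>T n\<close> is a measurable function on the product space over \<open>{..<n}\<close>. The
  additional \<open>T 0\<close> is a constant and irrelevant for the limit.
\<close>

definition empirically_identifiable ::
    "'x measure \<Rightarrow> 't set \<Rightarrow> ('t \<Rightarrow> (nat \<Rightarrow> 'x) measure) \<Rightarrow> ('t \<Rightarrow> 'l::metric_space) \<Rightarrow> bool" where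
  "empirically_identifiable S \<Theta> P g \<longleftrightarrow>
     (\<exists>T. (\<forall>n. T n \<in> (\<Pi>\<^sub>M i\<in>{..<n}. S) \<rightarrow>\<^sub>M borel) \<and>
          (\<forall>\<theta>\<in>\<Theta>. tendsto_in_probability (P \<theta>) (\<lambda>n x. T n (restrict x {..<n})) (g \<theta>)))"

text \<open>The normal distribution with mean \<open>m\<close> and variance \<open>v \<ge> 0\<close>, a point mass if \<open>v = 0\<close>.\<close>

definition normal_dist :: "real \<Rightarrow> real \<Rightarrow> real measure" where
  "normal_dist m v =
     (if v = 0 then return borel m else density lborel (normal_density m (sqrt v)))"

text \<open>
  \<open>N\<close> is the \<open>n\<close>-variate Gaussian distribution with mean vector \<open>(m i)\<close> and covariance matrix
  \<open>(C i j)\<close>, where \<open>i, j < n\<close>. As singular covariance matrices are allowed, this is not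
  expressed by a density but by the requirement that each linear form \<open>\<Sum>i<n. a i * x i\<close> has the
  one-dimensional normal distribution with the corresponding mean and variance. Symmetry and
  positive semidefiniteness of the matrix are part of the definition.
\<close>

definition multivariate_normal ::
    "nat \<Rightarrow> (nat \<Rightarrow> real) \<Rightarrow> (nat \<Rightarrow> nat \<Rightarrow> real) \<Rightarrow> (nat \<Rightarrow> real) measure \<Rightarrow> bool" where
  "multivariate_normal n m C N \<longleftrightarrow>
     (\<forall>i<n. \<forall>j<n. C i j = C j i) \<and>
     (\<forall>a. 0 \<le> (\<Sum>i<n. \<Sum>j<n. a i * a j * C i j)) \<and>
     sets N = sets (\<Pi>\<^sub>M i\<in>{..<n}. borel) \<and>
     (\<forall>a. distr N borel (\<lambda>x. \<Sum>i<n. a i * x i) =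
          normal_dist (\<Sum>i<n. a i * m i) (\<Sum>i<n. \<Sum>j<n. a i * a j * C i j))"

definition equicorrelated_gaussian ::
    "real \<Rightarrow> real \<Rightarrow> real \<Rightarrow> (nat \<Rightarrow> real) measure \<Rightarrow> bool" where
  "equicorrelated_gaussian \<mu> \<sigma>2 \<rho> P \<longleftrightarrow>
     prob_space P \<and> sets P = sets (\<Pi>\<^sub>M i\<in>UNIV. borel) \<and>
     (\<forall>n. multivariate_normal n (\<lambda>i. \<mu>) (\<lambda>i j. if i = j then \<sigma>2 else \<rho> * \<sigma>2)
            (distr P (\<Pi>\<^sub>M i\<in>{..<n}. borel) (\<lambda>x. restrict x {..<n})))"

definition param_space :: "(real \<times> real \<times> real) set" where
  "param_space = {(\<mu>, \<sigma>2, \<rho>). \<sigma>2 > 0 \<and> 0 \<le> \<rho> \<and> \<rho> \<le> 1}"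

text \<open>
  The distribution exists for every parameter: take
  \<open>\<mu> + sqrt (\<rho> * \<sigma>2) * Z 0 + sqrt ((1 - \<rho>) * \<sigma>2) * Z (Suc i)\<close> with independent standard normal
  variables \<open>Z j\<close>.
\<close>

lemma (in prob_space) distr_linear_std_normal:
  assumes fin: "finite J" and ind: "indep_vars (\<lambda>_. borel) Z J"
    and std: "\<And>j. j \<in> J \<Longrightarrow> distributed M lborel (Z j) std_normal_density"
  shows "distr M borel (\<lambda>\<omega>. c + (\<Sum>j\<in>J. b j * Z j \<omega>)) = normal_dist c (\<Sum>j\<in>J. (b j)\<^sup>2)"
proof -
  define K where "K = {j\<in>J. b j \<noteq> 0}"
  have K: "finite K" "K \<subseteq> J" "\<And>j. j \<in> K \<Longrightarrow> b j \<noteq> 0"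
    using fin by (auto simp: K_def)
  have s1: "(\<Sum>j\<in>J. b j * Z j \<omega>) = (\<Sum>j\<in>K. b j * Z j \<omega>)" for \<omega>
    by (rule sum.mono_neutral_right) (auto simp: K_def fin)
  have s2: "(\<Sum>j\<in>J. (b j)\<^sup>2) = (\<Sum>j\<in>K. (b j)\<^sup>2)"
    by (rule sum.mono_neutral_right) (auto simp: K_def fin)
  show ?thesis
  proof (cases "K = {}")
    case True
    then show ?thesis
      unfolding s1 s2 by (simp add: normal_dist_def distr_const)
  next
    case False
    have pos: "0 < (\<Sum>j\<in>K. (b j)\<^sup>2)"
      using K False by (intro sum_pos) auto
    have "distributed M lborel (\<lambda>\<omega>. \<Sum>j\<in>K. b j * Z j \<omega>)
        (normal_density (\<Sum>j\<in>K. 0) (sqrt (\<Sum>j\<in>K. \<bar>b j\<bar>\<^sup>2)))"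
    proof (rule sum_indep_normal)
      show "indep_vars (\<lambda>i. borel) (\<lambda>j \<omega>. b j * Z j \<omega>) K"
        by (rule indep_vars_compose2[OF indep_vars_subset[OF ind K(2)]]) simp
      show "distributed M lborel (\<lambda>\<omega>. b j * Z j \<omega>) (normal_density 0 \<bar>b j\<bar>)" if "j \<in> K" for j
        using normal_density_affine[of "Z j" 0 1 "b j" 0] std[of j] K that by auto
    qed (use K False in auto)
    then have "distributed M lborel (\<lambda>\<omega>. c + 1 * (\<Sum>j\<in>K. b j * Z j \<omega>))
        (normal_density (c + 1 * 0) (\<bar>1\<bar> * sqrt (\<Sum>j\<in>K. (b j)\<^sup>2)))"
      using pos by (intro normal_density_affine) auto
    then have "distr M lborel (\<lambda>\<omega>. c + (\<Sum>j\<in>K. b j * Z j \<omega>))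
        = density lborel (normal_density c (sqrt (\<Sum>j\<in>K. (b j)\<^sup>2)))"
      by (simp add: distributed_def)
    moreover have "distr M lborel f = distr M borel f" for f :: "'a \<Rightarrow> real"
      by (rule distr_cong) auto
    ultimately show ?thesis
      using pos unfolding s1 s2 by (simp add: normal_dist_def)
  qed
qed

lemma equicorrelated_gaussian_exists:
  assumes "(\<mu>, \<sigma>2, \<rho>) \<in> param_space"
  shows "\<exists>P. equicorrelated_gaussian \<mu> \<sigma>2 \<rho> P"
proof -
  have par: "0 < \<sigma>2" "0 \<le> \<rho>" "\<rho> \<le> 1"
    using assms by (auto simp: param_space_def)
  define D where "D = density lborel std_normal_density"
  define M where "M = (\<Pi>\<^sub>M i\<in>(UNIV::nat set). D)"
  have D: "prob_space D" unfolding D_def by (rule prob_space_normal_density) simp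
  have sD[simp, measurable_cong]: "sets D = sets borel" by (simp add: D_def)
  interpret M: prob_space M unfolding M_def by (rule prob_space_PiM) (rule D)
  have sM[measurable_cong]: "sets M = sets (\<Pi>\<^sub>M i\<in>(UNIV::nat set). borel)"
    unfolding M_def by (rule sets_PiM_cong) auto
  have comp: "distr M D (\<lambda>\<omega>. \<omega> i) = D" for i
    unfolding M_def by (rule distr_PiM_component) (auto simp: D)
  have comp': "distr M borel (\<lambda>\<omega>. \<omega> i) = D" for i
    using comp[of i] distr_cong[of M M borel D "\<lambda>\<omega>. \<omega> i" "\<lambda>\<omega>. \<omega> i"] by simp
  have std: "distributed M lborel (\<lambda>\<omega>. \<omega> i) std_normal_density" for i
    unfolding distributed_def
  proof (intro conjI)
    have "distr M lborel (\<lambda>\<omega>. \<omega> i) = distr M D (\<lambda>\<omega>. \<omega> i)"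
      by (rule distr_cong) auto
    then show "distr M lborel (\<lambda>\<omega>. \<omega> i) = density lborel std_normal_density"
      using comp[of i] by (simp add: D_def)
  qed measurable
  have ind: "M.indep_vars (\<lambda>_. borel) (\<lambda>i \<omega>. \<omega> i) (UNIV :: nat set)"
  proof (subst M.indep_vars_iff_distr_eq_PiM)
    have "distr M (\<Pi>\<^sub>M i\<in>UNIV. borel) (\<lambda>x. \<lambda>i\<in>UNIV. x i) = distr M M (\<lambda>x. x)"
      by (rule distr_cong) (auto simp: sM)
    also have "\<dots> = (\<Pi>\<^sub>M i\<in>UNIV. distr M borel (\<lambda>\<omega>. \<omega> i))"
      unfolding comp' by (simp add: M_def)
    finally show "distr M (\<Pi>\<^sub>M i\<in>UNIV. borel) (\<lambda>x. \<lambda>i\<in>UNIV. x i) =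
      (\<Pi>\<^sub>M i\<in>UNIV. distr M borel (\<lambda>\<omega>. \<omega> i))" .
  qed (auto intro: measurable_component_singleton)
  define s where "s = sqrt (\<rho> * \<sigma>2)"
  define t where "t = sqrt ((1 - \<rho>) * \<sigma>2)"
  have s2: "s\<^sup>2 = \<rho> * \<sigma>2" and t2: "t\<^sup>2 = (1 - \<rho>) * \<sigma>2"
    using par by (auto simp: s_def t_def)
  define X where "X \<omega> i = \<mu> + s * \<omega> 0 + t * \<omega> (Suc i)" for \<omega> :: "nat \<Rightarrow> real" and i
  define P where "P = distr M (\<Pi>\<^sub>M i\<in>UNIV. borel) X"
  have X[measurable]: "X \<in> M \<rightarrow>\<^sub>M (\<Pi>\<^sub>M i\<in>UNIV. borel)"
    by (rule measurable_PiM_single') (auto simp: X_def)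
  have quad: "(\<Sum>i<n. \<Sum>j<n. a i * a j * (if i = j then \<sigma>2 else \<rho> * \<sigma>2)) =
      (s * (\<Sum>i<n. a i))\<^sup>2 + (\<Sum>i<n. (t * a i)\<^sup>2)" for a :: "nat \<Rightarrow> real" and n
  proof -
    have "(\<Sum>i<n. \<Sum>j<n. a i * a j * (if i = j then \<sigma>2 else \<rho> * \<sigma>2)) =
        (\<Sum>i<n. \<Sum>j<n. \<rho> * \<sigma>2 * (a i * a j) + (if i = j then (1 - \<rho>) * \<sigma>2 * (a i)\<^sup>2 else 0))"
      by (intro sum.cong refl) (auto simp: algebra_simps power2_eq_square)
    also have "\<dots> = \<rho> * \<sigma>2 * (\<Sum>i<n. a i)\<^sup>2 + (1 - \<rho>) * \<sigma>2 * (\<Sum>i<n. (a i)\<^sup>2)"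
      unfolding power2_eq_square sum_product by (simp add: sum.distrib sum_distrib_left)
    finally show ?thesis
      unfolding power_mult_distrib s2 t2 by (simp add: sum_distrib_left)
  qed
  have lin: "distr P borel (\<lambda>x. \<Sum>i<n. a i * x i) =
      normal_dist (\<Sum>i<n. a i * \<mu>) (\<Sum>i<n. \<Sum>j<n. a i * a j * (if i = j then \<sigma>2 else \<rho> * \<sigma>2))"
    for a n
  proof -
    define b where "b j = (case j of 0 \<Rightarrow> s * (\<Sum>i<n. a i) | Suc i \<Rightarrow> t * a i)" for j
    have split: "(\<Sum>j<Suc n. f j) = f 0 + (\<Sum>i<n. f (Suc i))" for f :: "nat \<Rightarrow> real"
      by (rule sum.lessThan_Suc_shift)
    have "distr P borel (\<lambda>x. \<Sum>i<n. a i * x i) = distr M borel (\<lambda>\<omega>. \<Sum>i<n. a i * X \<omega> i)"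
      unfolding P_def by (subst distr_distr) (auto simp: comp_def)
    also have "(\<lambda>\<omega>. \<Sum>i<n. a i * X \<omega> i) = (\<lambda>\<omega>. (\<Sum>i<n. a i * \<mu>) + (\<Sum>j<Suc n. b j * \<omega> j))"
      unfolding split
      by (auto simp: X_def b_def fun_eq_iff algebra_simps sum.distrib sum_distrib_left sum_distrib_right)
    also have "distr M borel \<dots> = normal_dist (\<Sum>i<n. a i * \<mu>) (\<Sum>j<Suc n. (b j)\<^sup>2)"
      by (rule M.distr_linear_std_normal)
         (auto intro: std M.indep_vars_subset[OF ind])
    also have "(\<Sum>j<Suc n. (b j)\<^sup>2) =
        (\<Sum>i<n. \<Sum>j<n. a i * a j * (if i = j then \<sigma>2 else \<rho> * \<sigma>2))"
      unfolding split quad by (simp add: b_def)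
    finally show ?thesis .
  qed
  have sP[measurable_cong]: "sets P = sets (\<Pi>\<^sub>M i\<in>UNIV. borel)" by (simp add: P_def)
  have "equicorrelated_gaussian \<mu> \<sigma>2 \<rho> P"
    unfolding equicorrelated_gaussian_def multivariate_normal_def
  proof (intro conjI allI impI)
    show "prob_space P" unfolding P_def by (rule M.prob_space_distr) simp
    fix n and a :: "nat \<Rightarrow> real"
    show "0 \<le> (\<Sum>i<n. \<Sum>j<n. a i * a j * (if i = j then \<sigma>2 else \<rho> * \<sigma>2))"
      unfolding quad by (simp add: sum_nonneg)
    have [measurable]: "(\<lambda>x. restrict x {..<n}) \<in> P \<rightarrow>\<^sub>M (\<Pi>\<^sub>M i\<in>{..<n}. borel)"
      by (rule measurable_restrict) measurable
    have "distr (distr P (\<Pi>\<^sub>M i\<in>{..<n}. borel) (\<lambda>x. restrict x {..<n})) borel (\<lambda>x. \<Sum>i<n. a i * x i)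
        = distr P borel (\<lambda>x. \<Sum>i<n. a i * x i)"
      by (subst distr_distr) (auto simp: comp_def intro!: distr_cong)
    then show "distr (distr P (\<Pi>\<^sub>M i\<in>{..<n}. borel) (\<lambda>x. restrict x {..<n})) borel
        (\<lambda>x. \<Sum>i<n. a i * x i) = normal_dist (\<Sum>i<n. a i * \<mu>)
        (\<Sum>i<n. \<Sum>j<n. a i * a j * (if i = j then \<sigma>2 else \<rho> * \<sigma>2))"
      unfolding lin .
  qed (auto simp: sP)
  then show ?thesis by blast
qed

end

theory Submission
  imports Defs
begin

text \<open>
  For \<open>\<rho> = 1\<close> all observations coincide almost surely, so an estimator only sees a single draw from
  \<open>N(\<mu>, \<sigma>\<^sup>2)\<close>. The laws \<open>N(0, 1)\<close> and \<open>N(1, 1)\<close> both dominate a fixed multiple of the Lebesgue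
  measure on \<open>[0, 1]\<close>, hence no sequence of functions of one draw can converge in probability to
  \<open>0\<close> under the first and to \<open>1\<close> under the second.
\<close>

text \<open>Composing with the restriction to \<open>{..<n}\<close> turns the defining property of
  the \<open>n\<close>-variate Gaussian into one about \<open>P\<close> itself, so linear forms can
  be evaluated on the whole sequence.\<close>

lemma equicorrelated_gaussian_linear_form:
  assumes "equicorrelated_gaussian \<mu> \<sigma>2 \<rho> P"
  shows "distr P borel (\<lambda>x. \<Sum>i<n. a i * x i) =
    normal_dist (\<Sum>i<n. a i * \<mu>) (\<Sum>i<n. \<Sum>j<n. a i * a j * (if i = j then \<sigma>2 else \<rho> * \<sigma>2))"
proof -
  have sP[measurable_cong]: "sets P = sets (\<Pi>\<^sub>M i\<in>UNIV. borel)"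
    using assms by (simp add: equicorrelated_gaussian_def)
  have [measurable]: "(\<lambda>x. restrict x {..<n}) \<in> P \<rightarrow>\<^sub>M (\<Pi>\<^sub>M i\<in>{..<n}. borel)"
    by (rule measurable_restrict) measurable
  have "distr P borel (\<lambda>x. \<Sum>i<n. a i * x i) =
      distr (distr P (\<Pi>\<^sub>M i\<in>{..<n}. borel) (\<lambda>x. restrict x {..<n})) borel (\<lambda>x. \<Sum>i<n. a i * x i)"
    by (subst distr_distr) (auto simp: comp_def intro!: distr_cong)
  then show ?thesis
    using assms by (simp add: equicorrelated_gaussian_def multivariate_normal_def)
qed

lemma equicorrelated_gaussian_marginal:
  assumes "equicorrelated_gaussian \<mu> \<sigma>2 \<rho> P"
  shows "distr P borel (\<lambda>x. x 0) = normal_dist \<mu> \<sigma>2"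
  using equicorrelated_gaussian_linear_form[OF assms, of "\<lambda>_. 1" 1] by simp

text \<open>At correlation 1 the difference of two coordinates has mean and variance 0, so its law
  is a point mass at 0. Countably many null sets are then united.\<close>

lemma equicorrelated_gaussian_AE_constant:
  assumes "equicorrelated_gaussian \<mu> \<sigma>2 1 P"
  shows "AE x in P. \<forall>i. x i = x 0"
proof -
  have sP[measurable_cong]: "sets P = sets (\<Pi>\<^sub>M i\<in>UNIV. borel)"
    using assms by (simp add: equicorrelated_gaussian_def)
  have "AE x in P. x i = x 0" if "i > 0" for i
  proof -
    \<comment> \<open>The coefficient vector of the linear form \<open>x i - x 0\<close>; its
      entries sum to 0.\<close>
    define a where "a j = (if j = i then 1 else 0) - (if j = 0 then 1 else 0 :: real)" for j
    have lin: "(\<Sum>j<Suc i. a j * f j) = f i - f 0" for f :: "nat \<Rightarrow> real"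
      using that
      by (simp add: a_def left_diff_distrib sum_subtractf if_distrib[of "\<lambda>y. y * _"] cong: if_cong)
    \<comment> \<open>All covariances equal \<open>\<sigma>2\<close>, so the quadratic form factors.
      The inner sum is \<open>lin\<close> applied to a constant function and vanishes.\<close>
    have "(\<Sum>j<Suc i. \<Sum>k<Suc i. a j * a k * (if j = k then \<sigma>2 else 1 * \<sigma>2)) =
        (\<Sum>j<Suc i. a j * (\<Sum>k<Suc i. a k * \<sigma>2))"
      unfolding sum_distrib_left by (intro sum.cong refl) simp
    then have "distr P borel (\<lambda>x. x i - x 0) = normal_dist 0 0"
      using equicorrelated_gaussian_linear_form[OF assms, of a "Suc i"] unfolding lin by simp
    then have "distr P borel (\<lambda>x. x i - x 0) = return borel 0"
      by (simp add: normal_dist_def)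
    moreover have "AE y in return borel (0::real). y = 0"
      by (subst AE_return) auto
    ultimately have "AE y in distr P borel (\<lambda>x. x i - x 0). y = 0" by (simp only:)
    then show ?thesis by (simp add: AE_distr_iff)
  qed
  then have "AE x in P. x i = x 0" for i
    by (cases "i = 0") auto
  then show ?thesis
    by (simp add: AE_all_countable)
qed

text \<open>The sample is almost surely the constant vector with entry \<open>x 0\<close>, and
  \<open>x 0\<close> has the law \<open>normal_dist \<mu> \<sigma>2\<close>. This reduces any event
  about the sample to one about a single normal draw.\<close>

lemma equicorrelated_gaussian_measure_constant:
  assumes eg: "equicorrelated_gaussian \<mu> \<sigma>2 1 P" and n: "n > 0"
    and [measurable]: "Measurable.pred (\<Pi>\<^sub>M i\<in>{..<n}. borel) Q"
  shows "measure P {x \<in> space P. Q (restrict x {..<n})} =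
    measure (normal_dist \<mu> \<sigma>2) {z. Q (\<lambda>i\<in>{..<n}. z)}"
proof -
  have sP[measurable_cong]: "sets P = sets (\<Pi>\<^sub>M i\<in>UNIV. borel)"
    using eg by (simp add: equicorrelated_gaussian_def)
  have [measurable]: "(\<lambda>x. restrict x {..<n}) \<in> P \<rightarrow>\<^sub>M (\<Pi>\<^sub>M i\<in>{..<n}. borel)"
    by (rule measurable_restrict) measurable
  have [measurable]: "(\<lambda>z. \<lambda>i\<in>{..<n}. z) \<in> borel \<rightarrow>\<^sub>M (\<Pi>\<^sub>M i\<in>{..<n}. borel :: real measure)"
    by (rule measurable_restrict) measurable
  have "measure P {x \<in> space P. Q (restrict x {..<n})} =
      measure P {x \<in> space P. Q (\<lambda>i\<in>{..<n}. x 0)}"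
  proof (rule measure_eq_AE)
    show "AE x in P. (x \<in> {x \<in> space P. Q (restrict x {..<n})}) =
        (x \<in> {x \<in> space P. Q (\<lambda>i\<in>{..<n}. x 0)})"
      using equicorrelated_gaussian_AE_constant[OF eg]
    proof eventually_elim
      case (elim x)
      then have "restrict x {..<n} = (\<lambda>i\<in>{..<n}. x 0)" by (auto simp: restrict_def fun_eq_iff)
      then show ?case by simp
    qed
  qed measurable
  also have "\<dots> = measure (distr P borel (\<lambda>x. x 0)) {z. Q (\<lambda>i\<in>{..<n}. z)}"
    by (subst measure_distr) (auto intro!: arg_cong[where f = "measure P"])
  finally show ?thesis
    unfolding equicorrelated_gaussian_marginal[OF eg] .
qed

text \<open>Points of the unit interval are at distance at most 1 from \<open>m\<close>, so there
  the density is at least its value at distance 1. That bound does not depend on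
  \<open>m\<close>.\<close>

lemma measure_normal_dist_ge:
  fixes A :: "real set"
  assumes m: "m \<in> {0..1}" and A[measurable]: "A \<in> sets borel"
  shows "std_normal_density 1 * measure lborel (A \<inter> {0..1}) \<le> measure (normal_dist m 1) A"
proof -
  have N: "normal_dist m 1 = density lborel (normal_density m 1)"
    by (simp add: normal_dist_def)
  interpret prob_space "normal_dist m 1"
    unfolding N by (rule prob_space_normal_density) simp
  have fin: "emeasure lborel (A \<inter> {0..1}) \<noteq> \<infinity>"
    using emeasure_mono[of "A \<inter> {0..1}" "{0..1}" lborel] by (auto simp: top_unique)
  have dens: "std_normal_density 1 \<le> normal_density m 1 x" if "x \<in> {0..1}" for x
  proof -
    have "\<bar>x - m\<bar> \<le> 1" using m that by auto
    then have "(x - m)\<^sup>2 \<le> 1" by (simp add: abs_square_le_1)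
    then show ?thesis by (simp add: normal_density_def divide_right_mono)
  qed
  have "ennreal (std_normal_density 1 * measure lborel (A \<inter> {0..1})) =
      ennreal (std_normal_density 1) * emeasure lborel (A \<inter> {0..1})"
    using fin by (simp add: emeasure_eq_ennreal_measure ennreal_mult)
  also have "\<dots> = (\<integral>\<^sup>+x. ennreal (std_normal_density 1) * indicator (A \<inter> {0..1}) x \<partial>lborel)"
    by (simp add: nn_integral_cmult_indicator)
  also have "\<dots> \<le> (\<integral>\<^sup>+x. ennreal (normal_density m 1 x) * indicator A x \<partial>lborel)"
    using dens by (intro nn_integral_mono) (auto simp: indicator_def intro!: ennreal_leI)
  also have "\<dots> = emeasure (normal_dist m 1) A"
    unfolding N by (subst emeasure_density) auto
  also have "\<dots> = ennreal (measure (normal_dist m 1) A)"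
    by (simp add: emeasure_eq_measure)
  finally show ?thesis by (simp add: ennreal_le_iff)
qed

theorem theorem3p4:
  fixes P :: "real \<times> real \<times> real \<Rightarrow> (nat \<Rightarrow> real) measure"
  assumes "\<And>\<mu> \<sigma>2 \<rho>. (\<mu>, \<sigma>2, \<rho>) \<in> param_space \<Longrightarrow> equicorrelated_gaussian \<mu> \<sigma>2 \<rho> (P (\<mu>, \<sigma>2, \<rho>))"
  shows "\<not> empirically_identifiable borel param_space P (\<lambda>(\<mu>, \<sigma>2, \<rho>). \<mu>)"
proof
  assume "empirically_identifiable borel param_space P (\<lambda>(\<mu>, \<sigma>2, \<rho>). \<mu>)"
  then obtain T where T[measurable]: "\<And>n. T n \<in> (\<Pi>\<^sub>M i\<in>{..<n}. borel) \<rightarrow>\<^sub>M borel"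
    and conv: "\<And>\<mu> \<sigma>2 \<rho>. (\<mu>, \<sigma>2, \<rho>) \<in> param_space \<Longrightarrow>
      tendsto_in_probability (P (\<mu>, \<sigma>2, \<rho>)) (\<lambda>n x. T n (restrict x {..<n})) \<mu>"
    unfolding empirically_identifiable_def by fastforce
  \<comment> \<open>The draws for which \<open>T n\<close> misses \<open>m\<close>. Any threshold
    below 1/2 would serve, since no value may be close to both 0 and 1.\<close>
  define A where "A m n = {z. dist (T n (\<lambda>i\<in>{..<n}. z)) m > 1/3}" for m n
  define c where "c = std_normal_density 1"
  have c: "c > 0" by (simp add: c_def normal_density_pos)
  have [measurable]: "(\<lambda>z. \<lambda>i\<in>{..<n}. z) \<in> borel \<rightarrow>\<^sub>M (\<Pi>\<^sub>M i\<in>{..<n}. borel :: real measure)" for n :: nat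
    by (rule measurable_restrict) measurable
  have A[measurable]: "A m n \<in> sets borel" for m n
    unfolding A_def by measurable
  have lim: "(\<lambda>n. measure (normal_dist m 1) (A m n)) \<longlonglongrightarrow> 0" for m
  proof (rule Lim_transform_eventually)
    have m: "(m, 1, 1) \<in> param_space" by (simp add: param_space_def)
    show "(\<lambda>n. measure (P (m, 1, 1)) {x \<in> space (P (m, 1, 1)).
        dist (T n (restrict x {..<n})) m > 1/3}) \<longlonglongrightarrow> 0"
      using conv[OF m] unfolding tendsto_in_probability_def by (auto dest: spec[of _ "1/3"])
    show "\<forall>\<^sub>F n in sequentially. measure (P (m, 1, 1)) {x \<in> space (P (m, 1, 1)).
        dist (T n (restrict x {..<n})) m > 1/3} = measure (normal_dist m 1) (A m n)"
      \<comment> \<open>The reduction to a single draw is stated for nonempty samples, so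
        \<open>n = 0\<close> is left out.\<close>
      using eventually_gt_at_top[of 0]
    proof eventually_elim
      case (elim n)
      show ?case
        unfolding A_def
        by (rule equicorrelated_gaussian_measure_constant[OF assms[OF m] elim]) measurable
    qed
  qed
  \<comment> \<open>Each draw is bad for mean 0 or for mean 1. The two bad sets thus have total
    length at least 1 within the unit interval, and each normal law charges its own with at least
    \<open>c\<close> times its length there.\<close>
  have "c \<le> measure (normal_dist 0 1) (A 0 n) + measure (normal_dist 1 1) (A 1 n)" for n
  proof -
    have cover: "A 0 n \<union> A 1 n = UNIV"
    proof (intro set_eqI iffI UNIV_I)
      fix z
      have "dist (T n (\<lambda>i\<in>{..<n}. z)) 0 > 1/3 \<or> dist (T n (\<lambda>i\<in>{..<n}. z)) 1 > 1/3"
        unfolding dist_real_def by arith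
      then show "z \<in> A 0 n \<union> A 1 n" by (simp add: A_def)
    qed
    have "1 = measure lborel ((A 0 n \<inter> {0..1}) \<union> (A 1 n \<inter> {0..1}))"
      unfolding Int_Un_distrib2[symmetric] cover by simp
    also have "\<dots> \<le> measure lborel (A 0 n \<inter> {0..1}) + measure lborel (A 1 n \<inter> {0..1})"
      by (rule measure_Un_le) auto
    finally have "c * 1 \<le> c * (measure lborel (A 0 n \<inter> {0..1}) + measure lborel (A 1 n \<inter> {0..1}))"
      using c by (intro mult_left_mono) auto
    also have "\<dots> \<le> measure (normal_dist 0 1) (A 0 n) + measure (normal_dist 1 1) (A 1 n)"
      unfolding c_def distrib_left by (intro add_mono measure_normal_dist_ge) auto
    finally show ?thesis by simp
  qed
  moreover have "(\<lambda>n. measure (normal_dist 0 1) (A 0 n) + measure (normal_dist 1 1) (A 1 n)) \<longlonglongrightarrow> 0"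
    using tendsto_add[OF lim[of 0] lim[of 1]] by simp
  ultimately have "c \<le> 0"
    by (intro LIMSEQ_le_const) auto
  with c show False by simp
qed

end
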